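(* Let $L>0$ and let $f:[-L,L]\longrightarrow\mathbb R$ be continuous and have bounded variation on $[-L,L]$. Then the antiperiodic Fourier series $$AS f(x)=\gamma+\sum_{n=0}^{\infty}\left(\alpha_n\cos\left(\frac{n\pi x}{L}+\frac{\pi x}{2L}\right)+\beta_n\sin\left(\frac{n\pi x}{L}+\frac{\pi x}{2L}\right)\right),$$ where $\gamma=\dfrac{f(-L)+f(L)}{2}$ and for $n=0,1,2,\dots$ $$\alpha_n=\frac{1}{L}\int_{-L}^{L}(f(x)-\gamma)\cos\left(\frac{n\pi x}{L}+\frac{\pi x}{2L}\right)dx,\qquad \beta_n=\frac{1}{L}\int_{-L}^{L}(f(x)-\gamma)\sin\left(\frac{n\pi x}{L}+\frac{\pi x}{2L}\right)dx,$$ is uniformly convergent on $[-L,L]$ and $AS f(x)=f(x)$ for all $x\in[-L,L]$.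
   Context: The terms of the series are indexed by $n$, each term being $\alpha_n\cos\left(\frac{n\pi x}{L}+\frac{\pi x}{2L}\right)+\beta_n\sin\left(\frac{n\pi x}{L}+\frac{\pi x}{2L}\right)$; uniform convergence means uniform convergence on $[-L,L]$ of the partial sums over $n=0,\dots,m$ as $m\to\infty$. No relation between $f(-L)$ and $f(L)$ is assumed. *)

theory Defs
  imports "HOL-Analysis.Analysis"
begin

text \<open>Bounded variation on \<open>[a, b]\<close>: the variation sums over all finite partitions
  \<open>a = t 0 < t 1 < \<dots> < t n = b\<close> have a common bound.  Only the values
  \<open>t 0, \<dots>, t n\<close> of the sequence \<open>t\<close> matter.\<close>

definition bounded_variation_on :: "real \<Rightarrow> real \<Rightarrow> (real \<Rightarrow> real) \<Rightarrow> bool" where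
  "bounded_variation_on a b f \<longleftrightarrow>
     (\<exists>M. \<forall>(n::nat) (t :: nat \<Rightarrow> real).
        t 0 = a \<and> t n = b \<and> (\<forall>i<n. t i < t (Suc i)) \<longrightarrow>
        (\<Sum>i<n. \<bar>f (t (Suc i)) - f (t i)\<bar>) \<le> M)"

definition AS_angle :: "real \<Rightarrow> nat \<Rightarrow> real \<Rightarrow> real" where
  "AS_angle L n x = real n * pi * x / L + pi * x / (2 * L)"

definition AS_gamma :: "real \<Rightarrow> (real \<Rightarrow> real) \<Rightarrow> real" where
  "AS_gamma L f = (f (- L) + f L) / 2"

definition AS_alpha :: "real \<Rightarrow> (real \<Rightarrow> real) \<Rightarrow> nat \<Rightarrow> real" where
  "AS_alpha L f n = 1 / L * integral {- L..L} (\<lambda>x. (f x - AS_gamma L f) * cos (AS_angle L n x))"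

definition AS_beta :: "real \<Rightarrow> (real \<Rightarrow> real) \<Rightarrow> nat \<Rightarrow> real" where
  "AS_beta L f n = 1 / L * integral {- L..L} (\<lambda>x. (f x - AS_gamma L f) * sin (AS_angle L n x))"

definition AS_term :: "real \<Rightarrow> (real \<Rightarrow> real) \<Rightarrow> nat \<Rightarrow> real \<Rightarrow> real" where
  "AS_term L f n x =
     AS_alpha L f n * cos (AS_angle L n x) + AS_beta L f n * sin (AS_angle L n x)"

text \<open>The value of the series, meaningful where the series converges.\<close>

definition AS :: "real \<Rightarrow> (real \<Rightarrow> real) \<Rightarrow> real \<Rightarrow> real" where
  "AS L f x = AS_gamma L f + (\<Sum>n. AS_term L f n x)"

end

theory Submission
  imports Defs
begin

text \<open>
  Put \<open>g = f - \<gamma>\<close>. The choice of \<open>\<gamma>\<close> makes \<open>g (- L) = - g L\<close>, so \<open>g\<close> extends to a continuous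
  function with \<open>g (x + 2 * L) = - g x\<close>, and the series is its Fourier series over the period
  \<open>4 * L\<close>: antiperiodicity kills the even frequencies, and the odd ones are the angles
  \<open>(2 * n + 1) * \<theta>\<close> with \<open>\<theta> = pi * x / (2 * L)\<close>. The theorem is thus a form of the
  Dirichlet--Jordan theorem, obtained here by combining three facts.

  First, Fejer's theorem (\<open>antiperiodic_fejer\<close>): the arithmetic means of the averages
  \<open>(s m + s (Suc m)) / 2\<close> of consecutive partial sums converge uniformly to \<open>g\<close>. Each odd-frequency
  partial sum stands for two consecutive partial sums of the full Fourier series over \<open>4 * L\<close>, so
  these are the usual Fejer means of even order; accordingly their kernel is \<open>cos \<theta>\<close> times the
  classical nonnegative Fejer kernel \<open>(sin (N * \<theta>) / sin \<theta>)\<^sup>2\<close>.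

  Second, bounded variation makes the \<open>n\<close>-th term of the series \<open>O (1 / n)\<close>, uniformly in \<open>x\<close>
  (\<open>AS_term_bound\<close>), by integrating by parts against \<open>g\<close>.

  Third, Hardy's Tauberian theorem (\<open>hardy_tauberian_uniform\<close>): a sequence whose increments are
  \<open>O (1 / n)\<close> converges uniformly as soon as its arithmetic means do. So the averages of consecutive
  partial sums converge uniformly to \<open>g\<close>, and they differ from the partial sums by half a term,
  which tends to \<open>0\<close> uniformly.
\<close>

section \<open>Integration by parts against a function of bounded variation\<close>

lemma integral_split_at_sequence:
  fixes h :: "real \<Rightarrow> real" and t :: "nat \<Rightarrow> real"
  assumes "mono t" and "h integrable_on {t 0..t n}"
  shows "integral {t 0..t n} h = (\<Sum>i<n. integral {t i..t (Suc i)} h)"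
  using assms(2)
proof (induction n)
  case 0
  then show ?case by simp
next
  case (Suc n)
  have le: "t 0 \<le> t n" "t n \<le> t (Suc n)"
    using assms(1) by (auto simp: mono_def)
  have "h integrable_on {t 0..t n}"
    by (rule integrable_on_subinterval[OF Suc.prems]) (use le in auto)
  with Suc.IH Henstock_Kurzweil_Integration.integral_combine[OF le Suc.prems] show ?case by simp
qed

lemma sum_by_parts:
  fixes u v :: "nat \<Rightarrow> real"
  shows "(\<Sum>i<n. u (Suc i) * (v (Suc i) - v i)) =
         u n * v n - u 0 * v 0 - (\<Sum>i<n. v i * (u (Suc i) - u i))"
  by (induction n) (simp_all add: algebra_simps)

text \<open>
  This is the estimate that Riemann--Stieltjes integration by parts,
  \<open>\<integral> g dF = g b * F b - g a * F a - \<integral> F dg\<close>, would give. Since \<open>g\<close> is uniformly continuous,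
  replacing it by a step function on a fine enough partition changes the integral of \<open>g * \<phi>\<close> by
  at most \<open>e\<close>, and for a step function integration by parts is summation by parts.
\<close>

lemma abs_integral_bounded_variation_le:
  fixes g F \<phi> :: "real \<Rightarrow> real"
  assumes ab: "a < b" and g: "continuous_on {a..b} g" and \<phi>: "continuous_on {a..b} \<phi>"
    and F: "\<And>y. (F has_real_derivative \<phi> y) (at y)"
    and B: "\<And>y. \<bar>F y\<bar> \<le> B"
    and V: "\<And>n t. t 0 = a \<Longrightarrow> t n = b \<Longrightarrow> (\<forall>i<n. t i < t (Suc i)) \<Longrightarrow>
             (\<Sum>i<n. \<bar>g (t (Suc i)) - g (t i)\<bar>) \<le> V"
  shows "\<bar>integral {a..b} (\<lambda>y. g y * \<phi> y)\<bar> \<le> B * (\<bar>g a\<bar> + \<bar>g b\<bar> + V)"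
proof (rule field_le_epsilon)
  fix e :: real assume e: "0 < e"
  obtain P where P: "P > 0" "\<And>y. y \<in> {a..b} \<Longrightarrow> \<bar>\<phi> y\<bar> \<le> P"
    using compact_imp_bounded[OF compact_continuous_image[OF \<phi> compact_Icc]]
    by (auto simp: bounded_pos)
  \<comment> \<open>An oscillation below \<open>d\<close> on each piece costs at most \<open>d * P * (b - a) = e\<close> in total.\<close>
  define d where "d = e / (P * (b - a))"
  have d: "d > 0" using e P ab by (simp add: d_def)
  have "uniformly_continuous_on {a..b} g"
    using g by (intro compact_uniformly_continuous) auto
  then obtain r where r: "r > 0"
    "\<And>y z. y \<in> {a..b} \<Longrightarrow> z \<in> {a..b} \<Longrightarrow> \<bar>y - z\<bar> < r \<Longrightarrow> \<bar>g y - g z\<bar> < d"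
    using d unfolding uniformly_continuous_on_def dist_real_def by metis
  obtain N where N: "N > 0" "(b - a) / r < real N"
    using reals_Archimedean2[of "(b - a) / r"] ab r(1)
    by (metis diff_gt_0_iff_gt divide_pos_pos gr0I less_asym of_nat_0)
  define t where "t i = a + real i * ((b - a) / N)" for i :: nat
  have t0: "t 0 = a" and tN: "t N = b" using N by (auto simp: t_def)
  have step: "t (Suc i) = t i + (b - a) / N" for i by (simp add: t_def distrib_right add_divide_distrib)
  have small: "(b - a) / N < r" using N r by (simp add: field_simps)
  have pos: "(b - a) / N > 0" using N ab by simp
  have mono: "mono t" using pos by (intro mono_iff_le_Suc[THEN iffD2]) (simp add: step)
  have sub: "{t i..t (Suc i)} \<subseteq> {a..b}" if "i < N" for i
    using monoD[OF mono, of 0 i] monoD[OF mono, of "Suc i" N] that t0 tN by auto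
  have cont: "continuous_on {a..b} (\<lambda>y. g y * \<phi> y)"
    by (intro continuous_intros g \<phi>)
  have piece: "\<bar>integral {t i..t (Suc i)} (\<lambda>y. g y * \<phi> y) -
      g (t (Suc i)) * (F (t (Suc i)) - F (t i))\<bar> \<le> d * P * ((b - a) / N)"
    if i: "i < N" for i
  proof -
    let ?I = "{t i..t (Suc i)}"
    have le: "t i \<le> t (Suc i)" using pos by (simp add: step)
    have c1: "continuous_on ?I (\<lambda>y. g y * \<phi> y)" "continuous_on ?I \<phi>" "continuous_on ?I g"
      using continuous_on_subset[OF cont sub[OF i]] continuous_on_subset[OF \<phi> sub[OF i]]
        continuous_on_subset[OF g sub[OF i]] by auto
    have "(\<phi> has_integral (F (t (Suc i)) - F (t i))) ?I"
      using F by (intro fundamental_theorem_of_calculus le)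
        (auto simp: has_real_derivative_iff_has_vector_derivative[symmetric]
              intro: has_field_derivative_at_within)
    then have "((\<lambda>y. g (t (Suc i)) * \<phi> y) has_integral
        (g (t (Suc i)) * (F (t (Suc i)) - F (t i)))) ?I"
      by (rule has_integral_mult_right)
    moreover have "((\<lambda>y. g y * \<phi> y) has_integral integral ?I (\<lambda>y. g y * \<phi> y)) ?I"
      by (intro integrable_integral integrable_continuous_interval c1)
    ultimately have I: "((\<lambda>y. g y * \<phi> y - g (t (Suc i)) * \<phi> y) has_integral
        (integral ?I (\<lambda>y. g y * \<phi> y) - g (t (Suc i)) * (F (t (Suc i)) - F (t i)))) ?I"
      by (rule has_integral_diff[rotated])
    have "\<bar>g y * \<phi> y - g (t (Suc i)) * \<phi> y\<bar> \<le> d * P" if y: "y \<in> ?I" for y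
    proof -
      have "y \<in> {a..b}" "t (Suc i) \<in> {a..b}" using sub[OF i] y le by auto
      moreover have "\<bar>y - t (Suc i)\<bar> < r" using y small step[of i] by auto
      ultimately have "\<bar>g y - g (t (Suc i))\<bar> * \<bar>\<phi> y\<bar> \<le> d * P"
        using r(2) P d by (intro mult_mono) (auto intro: less_imp_le)
      then show ?thesis by (simp add: abs_mult[symmetric] left_diff_distrib)
    qed
    then have "\<bar>integral ?I (\<lambda>y. g y * \<phi> y) - g (t (Suc i)) * (F (t (Suc i)) - F (t i))\<bar>
        \<le> d * P * (t (Suc i) - t i)"
      using has_integral_bound_real[OF _ finite.emptyI I, of "d * P"] d P le by simp
    then show ?thesis by (simp add: step)
  qed
  have "integral {a..b} (\<lambda>y. g y * \<phi> y) = (\<Sum>i<N. integral {t i..t (Suc i)} (\<lambda>y. g y * \<phi> y))"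
    using integral_split_at_sequence[OF mono, of "\<lambda>y. g y * \<phi> y" N] cont t0 tN
    by (simp add: integrable_continuous_interval)
  then have "\<bar>integral {a..b} (\<lambda>y. g y * \<phi> y) - (\<Sum>i<N. g (t (Suc i)) * (F (t (Suc i)) - F (t i)))\<bar>
      \<le> (\<Sum>i<N. d * P * ((b - a) / N))"
    by (simp only: sum_subtractf[symmetric])
      (intro order_trans[OF sum_abs] sum_mono piece, simp)
  also have "\<dots> = e" using N P ab by (simp add: d_def)
  finally have A: "\<bar>integral {a..b} (\<lambda>y. g y * \<phi> y) - (\<Sum>i<N. g (t (Suc i)) * (F (t (Suc i)) - F (t i)))\<bar> \<le> e" .
  have "\<bar>\<Sum>i<N. F (t i) * (g (t (Suc i)) - g (t i))\<bar> \<le> (\<Sum>i<N. B * \<bar>g (t (Suc i)) - g (t i)\<bar>)"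
    by (intro order_trans[OF sum_abs] sum_mono) (simp add: abs_mult B mult_right_mono)
  also have "\<dots> = B * (\<Sum>i<N. \<bar>g (t (Suc i)) - g (t i)\<bar>)" by (simp add: sum_distrib_left)
  also have "\<dots> \<le> B * V"
    using V[OF t0 tN] pos B[of 0] by (intro mult_left_mono) (auto simp: step)
  finally have s: "\<bar>\<Sum>i<N. F (t i) * (g (t (Suc i)) - g (t i))\<bar> \<le> B * V" .
  have "\<bar>g b * F b\<bar> \<le> B * \<bar>g b\<bar>" "\<bar>g a * F a\<bar> \<le> B * \<bar>g a\<bar>"
    using B by (simp_all add: abs_mult mult.commute mult_right_mono)
  with s have "\<bar>\<Sum>i<N. g (t (Suc i)) * (F (t (Suc i)) - F (t i))\<bar> \<le> B * (\<bar>g a\<bar> + \<bar>g b\<bar> + V)"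
    using sum_by_parts[of "\<lambda>i. g (t i)" "\<lambda>i. F (t i)" N] by (simp add: t0 tN algebra_simps)
  with A show "\<bar>integral {a..b} (\<lambda>y. g y * \<phi> y)\<bar> \<le> B * (\<bar>g a\<bar> + \<bar>g b\<bar> + V) + e"
    by linarith
qed

section \<open>A uniform Tauberian theorem\<close>

text \<open>
  Subtracting the sums up to \<open>N + k\<close> and up to \<open>N\<close> turns the hypothesis on the means into one on the
  window \<open>N, \<dots>, N + k - 1\<close>, at the price of a factor of about \<open>2 * N / k\<close> in the error. Inside the
  window the sequence drifts from its value at \<open>N\<close> by at most \<open>k * C / N\<close>. With \<open>k\<close> close to
  \<open>N / q\<close> the drift is about \<open>C / q\<close>, made small by the choice of \<open>q\<close>; the factor \<open>2 * q\<close> is then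
  a constant, absorbed by taking the means accurate enough.
\<close>

lemma hardy_tauberian_uniform:
  fixes b :: "nat \<Rightarrow> 'a \<Rightarrow> real" and g :: "'a \<Rightarrow> real"
  assumes step: "\<And>n x. x \<in> X \<Longrightarrow> \<bar>b (Suc n) x - b n x\<bar> \<le> C / (real n + 1)"
    and means: "\<And>e. e > 0 \<Longrightarrow>
      \<forall>\<^sub>F N in sequentially. \<forall>x\<in>X. \<bar>\<Sum>m<N. b m x - g x\<bar> \<le> e * real N"
  shows "uniform_limit X b g sequentially"
proof (cases "X = {}")
  case False
  then obtain x0 where "x0 \<in> X" by blast
  then have C: "C \<ge> 0" using order_trans[OF abs_ge_zero step[of x0 0]] by simp
  show ?thesis
  proof (rule uniform_limitI)
    fix e :: real assume e: "e > 0"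
    obtain q :: nat where q: "q > 0" "4 * C / e < real q"
      using reals_Archimedean2[of "4 * C / e"] C e
      by (metis divide_nonneg_pos gr0I mult_nonneg_nonneg not_le of_nat_0 zero_le_numeral)
    \<comment> \<open>The error will be \<open>(2 * q + 1) * d + 2 * C / q\<close>; each summand gets \<open>e / 2\<close>.\<close>
    define d where "d = e / (2 * (2 * real q + 1))"
    have d: "d > 0" using e by (simp add: d_def)
    obtain N0 where N0: "\<And>N x. N \<ge> N0 \<Longrightarrow> x \<in> X \<Longrightarrow> \<bar>\<Sum>m<N. b m x - g x\<bar> \<le> d * real N"
      using means[OF d] by (auto simp: eventually_sequentially)
    have "dist (b N x) (g x) < e" if N: "N \<ge> max N0 q" and x: "x \<in> X" for N x
    proof -
      \<comment> \<open>Adding \<open>1\<close> gives \<open>N / q \<le> k\<close>; \<open>q \<le> N\<close> still ensures \<open>k \<le> 2 * N / q\<close>.\<close>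
      define k where "k = N div q + 1"
      have k: "k > 0" by (simp add: k_def)
      have "N < q * k" using q dividend_less_times_div[of q N] by (simp add: k_def)
      then have Nk: "real N \<le> real q * real k" by (metis less_imp_le of_nat_le_iff of_nat_mult)
      have "q * k \<le> 2 * N" using N q by (simp add: k_def) (metis add_mono mult_2 times_div_less_eq_dividend)
      then have kN: "real q * real k \<le> 2 * real N" by (metis of_nat_le_iff of_nat_mult of_nat_numeral)
      have Npos: "real N > 0" using N q by simp
      have drift: "\<bar>b (N + j) x - b N x\<bar> \<le> real j * (C / (real N + 1))" for j
      proof (induction j)
        case (Suc j)
        have "C / (real (N + j) + 1) \<le> C / (real N + 1)"
          using C by (intro divide_left_mono) auto
        then have "\<bar>b (Suc (N + j)) x - b (N + j) x\<bar> \<le> C / (real N + 1)"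
          using step[OF x, of "N + j"] by linarith
        moreover have "real (Suc j) * (C / (real N + 1)) = real j * (C / (real N + 1)) + C / (real N + 1)"
          by (simp only: of_nat_Suc distrib_right mult_1_left)
        ultimately show ?case using Suc.IH unfolding add_Suc_right by linarith
      qed simp
      have drift': "\<bar>\<Sum>j<k. b (N + j) x - b N x\<bar> \<le> real k * (real k * (C / (real N + 1)))"
      proof -
        have "\<bar>\<Sum>j<k. b (N + j) x - b N x\<bar> \<le> (\<Sum>j<k. real k * (C / (real N + 1)))"
        proof (intro order_trans[OF sum_abs] sum_mono)
          fix j assume "j \<in> {..<k}"
          then have "real j * (C / (real N + 1)) \<le> real k * (C / (real N + 1))"
            using C by (intro mult_right_mono) auto
          with drift[of j] show "\<bar>b (N + j) x - b N x\<bar> \<le> real k * (C / (real N + 1))" by linarith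
        qed
        then show ?thesis by simp
      qed
      have "(\<Sum>m<N + k. b m x - g x) = (\<Sum>m<N. b m x - g x) + (\<Sum>j<k. b (N + j) x - g x)"
        by (induction k) simp_all
      also have "(\<Sum>j<k. b (N + j) x - g x) = (\<Sum>j<k. b (N + j) x - b N x) + real k * (b N x - g x)"
        by (simp add: sum_subtractf algebra_simps)
      finally have "real k * (b N x - g x) =
          (\<Sum>m<N + k. b m x - g x) - (\<Sum>m<N. b m x - g x) - (\<Sum>j<k. b (N + j) x - b N x)"
        by simp
      moreover have A: "\<bar>\<Sum>m<N. b m x - g x\<bar> \<le> d * real N"
        and A': "\<bar>\<Sum>m<N + k. b m x - g x\<bar> \<le> d * real (N + k)"
        using N x N0[of N x] N0[of "N + k" x] by auto
      ultimately have "\<bar>real k * (b N x - g x)\<bar> \<le> d * real (N + k) + d * real N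
          + real k * (real k * (C / (real N + 1)))"
        using A A' drift' by linarith
      also have "\<dots> = d * (2 * real N + real k) + real k * (real k * (C / (real N + 1)))"
        by (simp add: algebra_simps)
      also have "\<dots> \<le> d * (2 * (real q * real k) + real k) + real k * (2 * C / real q)"
      proof (intro add_mono mult_left_mono)
        have "real k * (C / (real N + 1)) \<le> (2 * real N / real q) * (C / real N)"
          using kN q C Npos
          by (intro mult_mono divide_left_mono) (auto simp: field_simps intro: add_pos_pos)
        then show "real k * (C / (real N + 1)) \<le> 2 * C / real q" using Npos by simp
      qed (use Nk d in auto)
      also have "\<dots> = real k * (e / 2 + 2 * C / real q)"
        by (simp add: d_def field_simps)
      finally have "\<bar>b N x - g x\<bar> \<le> e / 2 + 2 * C / real q"
        using k by (simp add: abs_mult)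
      also have "\<dots> < e" using q e by (simp add: field_simps)
      finally show ?thesis by (simp add: dist_real_def)
    qed
    then show "\<forall>\<^sub>F N in sequentially. \<forall>x\<in>X. dist (b N x) (g x) < e"
      unfolding eventually_sequentially by blast
  qed
qed auto

section \<open>The Fejer kernel\<close>

definition odd_dirichlet_kernel :: "nat \<Rightarrow> real \<Rightarrow> real" where
  "odd_dirichlet_kernel m \<theta> = (\<Sum>n<m. cos ((2 * real n + 1) * \<theta>))"

text \<open>
  The sum of the first \<open>N\<close> Dirichlet kernels, in the variable \<open>2 * \<theta>\<close> and without the factor
  \<open>1 / N\<close>. Being a trigonometric polynomial, it needs no special value at the zeros of \<open>sin \<theta>\<close>,
  where the closed form \<open>(sin (N * \<theta>) / sin \<theta>)\<^sup>2\<close> is singular.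
\<close>

definition fejer_kernel :: "nat \<Rightarrow> real \<Rightarrow> real" where
  "fejer_kernel N \<theta> = (\<Sum>m<N. 1 + 2 * (\<Sum>k<m. cos (2 * real (Suc k) * \<theta>)))"

lemma sin_mult_dirichlet_kernel:
  "sin \<theta> * (1 + 2 * (\<Sum>k<m. cos (2 * real (Suc k) * \<theta>))) = sin ((2 * real m + 1) * \<theta>)"
proof (induction m)
  case (Suc m)
  have "(2 * real (Suc m) + 1) * \<theta> = 2 * real (Suc m) * \<theta> + \<theta>"
       "(2 * real m + 1) * \<theta> = 2 * real (Suc m) * \<theta> - \<theta>"
    by (simp_all add: algebra_simps)
  with Suc show ?case by (simp only: sin_add sin_diff sum.lessThan_Suc) (simp add: algebra_simps)
qed simp

text \<open>
  The increment from \<open>N\<close> to \<open>Suc N\<close> is \<open>sin \<theta> * sin ((2 * N + 1) * \<theta>)\<close> on the left, by the closed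
  form of the Dirichlet kernel, and \<open>sin\<^sup>2 ((N + 1) * \<theta>) - sin\<^sup>2 (N * \<theta>)\<close> on the right; these agree.
\<close>

lemma fejer_kernel_mult_sin_squared:
  "fejer_kernel N \<theta> * (sin \<theta>)\<^sup>2 = (sin (real N * \<theta>))\<^sup>2"
proof (induction N)
  case (Suc N)
  have "fejer_kernel (Suc N) \<theta> * (sin \<theta>)\<^sup>2 =
      (sin (real N * \<theta>))\<^sup>2 + sin \<theta> * sin ((2 * real N + 1) * \<theta>)"
    unfolding sin_mult_dirichlet_kernel[symmetric] Suc[symmetric]
    by (simp add: fejer_kernel_def power2_eq_square algebra_simps)
  also have "(2 * real N + 1) * \<theta> = (real N * \<theta> + \<theta>) + real N * \<theta>"
    by (simp add: algebra_simps)
  also have "(sin (real N * \<theta>))\<^sup>2 + sin \<theta> * sin (\<dots>) = (sin (real N * \<theta> + \<theta>))\<^sup>2"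
  proof -
    define a where "a = real N * \<theta>"
    have "(sin a)\<^sup>2 = 1 - (cos a)\<^sup>2" "(sin \<theta>)\<^sup>2 = 1 - (cos \<theta>)\<^sup>2" by (simp_all add: sin_squared_eq)
    then show ?thesis unfolding a_def[symmetric] sin_add cos_add by algebra
  qed
  also have "real N * \<theta> + \<theta> = real (Suc N) * \<theta>" by (simp add: algebra_simps)
  finally show ?case .
qed (simp add: fejer_kernel_def)

lemma fejer_kernel_nonneg: "fejer_kernel N \<theta> \<ge> 0"
proof (cases "sin \<theta> = 0")
  case True
  then obtain i :: int where i: "\<theta> = of_int i * pi" by (auto simp: sin_zero_iff_int2)
  have "cos (2 * real (Suc k) * \<theta>) = 1" for k
  proof -
    have "2 * real (Suc k) * \<theta> = 2 * pi * of_int (int (Suc k) * i)" by (simp add: i)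
    then show ?thesis by (simp only: cos_int_2pin)
  qed
  then show ?thesis by (simp add: fejer_kernel_def sum_nonneg)
next
  case False
  then have "fejer_kernel N \<theta> = (sin (real N * \<theta>) / sin \<theta>)\<^sup>2"
    using fejer_kernel_mult_sin_squared[of N \<theta>] by (simp add: field_simps)
  then show ?thesis by simp
qed

text \<open>
  Multiplication by \<open>cos \<theta>\<close> shifts each even frequency \<open>2 * k\<close> to its two odd neighbours. The right
  side is the kernel that produces the sum of the averages of consecutive partial sums of the
  antiperiodic series, so those means inherit the positivity of the Fejer kernel.
\<close>

lemma cos_mult_fejer_kernel:
  "cos \<theta> * fejer_kernel N \<theta> =
     (\<Sum>m<N. odd_dirichlet_kernel m \<theta> + odd_dirichlet_kernel (Suc m) \<theta>)"
proof -
  have "cos \<theta> * (1 + 2 * (\<Sum>k<m. cos (2 * real (Suc k) * \<theta>))) =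
      odd_dirichlet_kernel m \<theta> + odd_dirichlet_kernel (Suc m) \<theta>" for m
  proof (induction m)
    case (Suc m)
    have "(2 * real (Suc m) + 1) * \<theta> = 2 * real (Suc m) * \<theta> + \<theta>"
         "(2 * real m + 1) * \<theta> = 2 * real (Suc m) * \<theta> - \<theta>"
      by (simp_all add: algebra_simps)
    then have "2 * cos \<theta> * cos (2 * real (Suc m) * \<theta>) =
        cos ((2 * real m + 1) * \<theta>) + cos ((2 * real (Suc m) + 1) * \<theta>)"
      by (simp only: cos_add cos_diff) simp
    with Suc show ?case by (simp add: odd_dirichlet_kernel_def algebra_simps)
  qed (simp add: odd_dirichlet_kernel_def)
  then show ?thesis by (simp add: fejer_kernel_def sum_distrib_left)
qed

text \<open>
  Every nonconstant frequency of the kernel runs through whole periods on an interval of length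
  \<open>2 * L\<close>, wherever \<open>x\<close> is, so only the \<open>N\<close> constants \<open>1\<close> contribute.
\<close>

lemma has_integral_fejer_kernel:
  assumes L: "L > 0"
  shows "((\<lambda>y. fejer_kernel N (pi * (x - y) / (2 * L))) has_integral 2 * L * real N) {- L..L}"
proof -
  have c: "((\<lambda>y. cos (2 * real (Suc k) * (pi * (x - y) / (2 * L)))) has_integral 0) {- L..L}" for k
  proof -
    define w where "w = real (Suc k) * pi / L"
    have w: "w > 0" "w * L = real (Suc k) * pi" using L by (simp_all add: w_def)
    have "((\<lambda>y. cos (w * (x - y))) has_integral
        (- sin (w * (x - L)) / w - (- sin (w * (x - - L)) / w))) {- L..L}"
      using L w
      by (intro fundamental_theorem_of_calculus)
         (auto simp: has_real_derivative_iff_has_vector_derivative[symmetric]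
            intro!: derivative_eq_intros)
    moreover have "sin (w * (x - - L)) = sin (w * (x - L))"
    proof -
      have "w * (x - - L) = w * (x - L) + 2 * pi * of_int (int (Suc k))"
        using w by (simp add: algebra_simps)
      then show ?thesis by (simp only: sin_add sin_int_2pin cos_int_2pin mult_zero_right mult_1_right add_0_right)
    qed
    moreover have "2 * real (Suc k) * (pi * (x - y) / (2 * L)) = w * (x - y)" for y
      using L by (simp add: w_def field_simps)
    ultimately show ?thesis by simp
  qed
  have one: "((\<lambda>y. 1) has_integral 2 * L) {- L..L}"
    using has_integral_const_real[of "1::real" "- L" L] L by simp
  have "((\<lambda>y. \<Sum>m<N. 1 + 2 * (\<Sum>k<m. cos (2 * real (Suc k) * (pi * (x - y) / (2 * L)))))
      has_integral (\<Sum>m<N. 2 * L + 2 * (\<Sum>k<m. 0))) {- L..L}"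
    by (intro has_integral_sum has_integral_add one has_integral_mult_right c) auto
  then show ?thesis by (simp add: fejer_kernel_def mult.commute)
qed

section \<open>Fejer's theorem for antiperiodic functions\<close>

text \<open>
  Where \<open>\<bar>h\<bar> \<ge> e\<close>, a compact set, \<open>q\<close> has no zero and hence a positive minimum; a large multiple of
  \<open>q\<close> dominates \<open>h\<close> there. This trades the usual splitting of an approximate identity into a
  near and a far part for one inequality that can be integrated.
\<close>

lemma continuous_le_eps_plus_multiple:
  fixes h q :: "'a::metric_space \<Rightarrow> real"
  assumes K: "compact K" and h: "continuous_on K h" and q: "continuous_on K q"
    and nonneg: "\<And>z. z \<in> K \<Longrightarrow> q z \<ge> 0"
    and zero: "\<And>z. z \<in> K \<Longrightarrow> q z = 0 \<Longrightarrow> h z = 0"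
    and e: "e > 0"
  obtains C where "C \<ge> 0" "\<And>z. z \<in> K \<Longrightarrow> \<bar>h z\<bar> \<le> e + C * q z"
proof (cases "\<forall>z\<in>K. \<bar>h z\<bar> < e")
  case True
  then show ?thesis by (intro that[of 0]) (auto intro: less_imp_le)
next
  case False
  define K' where "K' = K \<inter> (\<lambda>z. \<bar>h z\<bar>) -` {e..}"
  have ne: "K' \<noteq> {}" using False by (auto simp: K'_def not_less)
  have "closed K'" unfolding K'_def
    by (intro continuous_closed_preimage continuous_intros h compact_imp_closed K)
  then have "compact K'" using compact_Int_closed[OF K] by (metis K'_def inf_left_idem)
  moreover have "continuous_on K' q" using q by (rule continuous_on_subset) (auto simp: K'_def)
  ultimately obtain z0 where z0: "z0 \<in> K'" "\<And>z. z \<in> K' \<Longrightarrow> q z0 \<le> q z"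
    using continuous_attains_inf[of K' q] ne by blast
  have "q z0 \<noteq> 0" using z0(1) zero[of z0] e by (auto simp: K'_def)
  then have q0: "q z0 > 0" using nonneg[of z0] z0(1) by (auto simp: K'_def)
  obtain H where H: "H > 0" "\<And>z. z \<in> K \<Longrightarrow> \<bar>h z\<bar> \<le> H"
    using compact_imp_bounded[OF compact_continuous_image[OF h K]] by (auto simp: bounded_pos)
  show ?thesis
  proof (rule that[of "H / q z0"])
    fix z assume z: "z \<in> K"
    show "\<bar>h z\<bar> \<le> e + H / q z0 * q z"
    proof (cases "\<bar>h z\<bar> < e")
      case True
      moreover have "0 \<le> H / q z0 * q z" using H q0 nonneg[OF z] by simp
      ultimately show ?thesis by linarith
    next
      case False
      then have "q z0 \<le> q z" using z z0(2)[of z] by (auto simp: K'_def)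
      then have "H / q z0 * q z0 \<le> H / q z0 * q z" using H q0 by (intro mult_left_mono) auto
      with H(2)[OF z] q0 e show ?thesis by simp
    qed
  qed (use H q0 in simp)
qed

text \<open>
  Write \<open>\<theta> = pi * (x - y) / (2 * L)\<close>. As the Fejer kernel \<open>F\<close> has total mass \<open>2 * L * N\<close>, the
  difference to be estimated is the integral of \<open>(g y * cos \<theta> - g x) * F \<theta>\<close>. The first factor is
  continuous in \<open>(x, y)\<close> and vanishes with \<open>sin \<theta>\<close>: this happens for \<open>x = y\<close>, where \<open>cos \<theta> = 1\<close>,
  and when \<open>x\<close> and \<open>y\<close> are opposite endpoints, where \<open>cos \<theta> = - 1\<close> and antiperiodicity gives
  \<open>g y = - g x\<close>. So it is at most \<open>e / 2 + C * sin\<^sup>2 \<theta>\<close>, and \<open>sin\<^sup>2 \<theta> * F \<theta> = sin\<^sup>2 (N * \<theta>)\<close> is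
  bounded: the second part contributes \<open>O (1)\<close>, negligible against \<open>N\<close>.
\<close>

lemma antiperiodic_fejer:
  fixes g :: "real \<Rightarrow> real"
  assumes L: "L > 0" and g: "continuous_on {- L..L} g" and anti: "g (- L) = - g L"
    and e: "e > 0"
  shows "\<forall>\<^sub>F N in sequentially. \<forall>x\<in>{- L..L}.
    \<bar>integral {- L..L} (\<lambda>y. g y * (cos (pi * (x - y) / (2 * L)) * fejer_kernel N (pi * (x - y) / (2 * L))))
      - 2 * L * real N * g x\<bar> \<le> e * (2 * L * real N)"
proof -
  define \<theta> where "\<theta> x y = pi * (x - y) / (2 * L)" for x y
  let ?K = "{- L..L} \<times> {- L..L}"
  have c1: "continuous_on ?K (\<lambda>z. g (fst z))"
    by (rule continuous_on_compose2[OF g continuous_on_fst[OF continuous_on_id]]) auto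
  have c2: "continuous_on ?K (\<lambda>z. g (snd z))"
    by (rule continuous_on_compose2[OF g continuous_on_snd[OF continuous_on_id]]) auto
  obtain C where C: "C \<ge> 0"
    "\<And>z. z \<in> ?K \<Longrightarrow> \<bar>g (snd z) * cos (\<theta> (fst z) (snd z)) - g (fst z)\<bar>
        \<le> e / 2 + C * (sin (\<theta> (fst z) (snd z)))\<^sup>2"
  proof (rule continuous_le_eps_plus_multiple[of ?K
        "\<lambda>z. g (snd z) * cos (\<theta> (fst z) (snd z)) - g (fst z)"
        "\<lambda>z. (sin (\<theta> (fst z) (snd z)))\<^sup>2" "e / 2"])
    show "continuous_on ?K (\<lambda>z. g (snd z) * cos (\<theta> (fst z) (snd z)) - g (fst z))"
      "continuous_on ?K (\<lambda>z. (sin (\<theta> (fst z) (snd z)))\<^sup>2)"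
      unfolding \<theta>_def using L by (auto intro!: continuous_intros c1 c2)
    fix z assume z: "z \<in> ?K" and "(sin (\<theta> (fst z) (snd z)))\<^sup>2 = 0"
    obtain x y where xy: "z = (x, y)" by (cases z)
    with z have b: "- L \<le> x" "x \<le> L" "- L \<le> y" "y \<le> L" by auto
    have "sin (\<theta> x y) = 0" using \<open>(sin (\<theta> (fst z) (snd z)))\<^sup>2 = 0\<close> xy by simp
    then obtain i :: int where "\<theta> x y = of_int i * pi" by (auto simp: sin_zero_iff_int2)
    then have "pi * (x - y) = pi * (of_int i * (2 * L))" using L by (simp add: \<theta>_def divide_eq_eq ac_simps)
    then have i: "x - y = of_int i * (2 * L)" by simp
    have "\<bar>of_int i * (2 * L)\<bar> \<le> 1 * (2 * L)" unfolding i[symmetric] using b by linarith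
    then have "\<bar>real_of_int i\<bar> \<le> 1" using L by (simp add: abs_mult)
    then have "i = 0 \<or> i = 1 \<or> i = -1" by linarith
    then have "x = y \<or> (x = L \<and> y = - L) \<or> (x = - L \<and> y = L)"
      using i b by auto
    then show "g (snd z) * cos (\<theta> (fst z) (snd z)) - g (fst z) = 0"
      using xy L anti by (auto simp: \<theta>_def)
  qed (use e in \<open>auto intro: compact_Times\<close>)
  obtain N0 :: nat where N0: "2 * C / e < real N0" using reals_Archimedean2 by blast
  have "\<bar>integral {- L..L} (\<lambda>y. g y * (cos (\<theta> x y) * fejer_kernel N (\<theta> x y)))
      - 2 * L * real N * g x\<bar> \<le> e * (2 * L * real N)"
    if N: "N \<ge> N0" and x: "x \<in> {- L..L}" for N x
  proof -
    let ?F = "\<lambda>y. fejer_kernel N (\<theta> x y)"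
    have F: "(?F has_integral 2 * L * real N) {- L..L}"
      using has_integral_fejer_kernel[OF L] by (simp add: \<theta>_def)
    have "continuous_on {- L..L} (\<lambda>y. g y * (cos (\<theta> x y) * ?F y))"
      unfolding fejer_kernel_def \<theta>_def using L by (intro continuous_intros g) auto
    then have "((\<lambda>y. g y * (cos (\<theta> x y) * ?F y)) has_integral
        integral {- L..L} (\<lambda>y. g y * (cos (\<theta> x y) * ?F y))) {- L..L}"
      by (intro integrable_integral integrable_continuous_interval)
    from has_integral_diff[OF this has_integral_mult_left[OF F, of "g x"]]
    have I: "((\<lambda>y. g y * (cos (\<theta> x y) * ?F y) - ?F y * g x) has_integral
        (integral {- L..L} (\<lambda>y. g y * (cos (\<theta> x y) * ?F y)) - 2 * L * real N * g x)) {- L..L}" .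
    have J: "((\<lambda>y. e / 2 * ?F y + C) has_integral (e / 2 * (2 * L * real N) + 2 * L * C)) {- L..L}"
      using has_integral_add[OF has_integral_mult_right[OF F, of "e / 2"] has_integral_const_real[of C "- L" L]] L
      by simp
    have "\<bar>g y * (cos (\<theta> x y) * ?F y) - ?F y * g x\<bar> \<le> e / 2 * ?F y + C" if y: "y \<in> {- L..L}" for y
    proof -
      have "\<bar>g y * (cos (\<theta> x y) * ?F y) - ?F y * g x\<bar> = \<bar>(g y * cos (\<theta> x y) - g x) * ?F y\<bar>"
        by (simp add: algebra_simps)
      also have "\<dots> = \<bar>g y * cos (\<theta> x y) - g x\<bar> * ?F y"
        by (simp add: abs_mult fejer_kernel_nonneg)
      also have "\<dots> \<le> (e / 2 + C * (sin (\<theta> x y))\<^sup>2) * ?F y"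
        using C(2)[of "(x, y)"] x y by (intro mult_right_mono fejer_kernel_nonneg) auto
      also have "\<dots> = e / 2 * ?F y + C * (sin (real N * \<theta> x y))\<^sup>2"
        unfolding fejer_kernel_mult_sin_squared[symmetric] by (simp add: algebra_simps)
      also have "C * (sin (real N * \<theta> x y))\<^sup>2 \<le> C * 1"
        using C(1) by (intro mult_left_mono) (simp_all add: abs_square_le_1)
      finally show ?thesis by simp
    qed
    then have "norm (integral {- L..L} (\<lambda>y. g y * (cos (\<theta> x y) * ?F y) - ?F y * g x))
        \<le> integral {- L..L} (\<lambda>y. e / 2 * ?F y + C)"
      using I J by (intro integral_norm_bound_integral) (auto simp: has_integral_integrable)
    then have "\<bar>integral {- L..L} (\<lambda>y. g y * (cos (\<theta> x y) * ?F y)) - 2 * L * real N * g x\<bar>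
        \<le> e / 2 * (2 * L * real N) + 2 * L * C"
      using I J by (simp add: integral_unique)
    also have "2 * L * C \<le> 2 * L * (e / 2 * real N)"
    proof (rule mult_left_mono)
      have "2 * C / e < real N" using N0 N by (meson less_le_trans of_nat_le_iff)
      then show "C \<le> e / 2 * real N" using e by (simp add: field_simps)
    qed (use L in simp)
    finally show ?thesis by (simp add: algebra_simps)
  qed
  then show ?thesis unfolding eventually_sequentially \<theta>_def by blast
qed

section \<open>The antiperiodic Fourier series\<close>

lemma AS_term_eq_integral:
  assumes L: "L > 0" and f: "continuous_on {- L..L} f"
  shows "AS_term L f n x = 1 / L * integral {- L..L}
    (\<lambda>y. (f y - AS_gamma L f) * cos ((2 * real n + 1) * (pi * (x - y) / (2 * L))))"
proof -
  have ang: "(2 * real n + 1) * (pi * (x - y) / (2 * L)) = AS_angle L n x - AS_angle L n y" for y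
    using L by (simp add: AS_angle_def field_simps)
  have c: "continuous_on {- L..L} (\<lambda>y. (f y - AS_gamma L f) * cos (AS_angle L n y))"
          "continuous_on {- L..L} (\<lambda>y. (f y - AS_gamma L f) * sin (AS_angle L n y))"
    unfolding AS_angle_def using L by (auto intro!: continuous_intros f)
  have "((\<lambda>y. (f y - AS_gamma L f) * cos (AS_angle L n y) * cos (AS_angle L n x) +
              (f y - AS_gamma L f) * sin (AS_angle L n y) * sin (AS_angle L n x)) has_integral
      (integral {- L..L} (\<lambda>y. (f y - AS_gamma L f) * cos (AS_angle L n y)) * cos (AS_angle L n x) +
       integral {- L..L} (\<lambda>y. (f y - AS_gamma L f) * sin (AS_angle L n y)) * sin (AS_angle L n x))) {- L..L}"
    by (intro has_integral_add has_integral_mult_left integrable_integral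
          integrable_continuous_interval c)
  then have "integral {- L..L} (\<lambda>y. (f y - AS_gamma L f) * cos (AS_angle L n x - AS_angle L n y)) =
      integral {- L..L} (\<lambda>y. (f y - AS_gamma L f) * cos (AS_angle L n y)) * cos (AS_angle L n x) +
       integral {- L..L} (\<lambda>y. (f y - AS_gamma L f) * sin (AS_angle L n y)) * sin (AS_angle L n x)"
    by (intro integral_unique) (simp add: cos_diff algebra_simps)
  then show ?thesis
    unfolding ang AS_term_def AS_alpha_def AS_beta_def
    by (simp only: distrib_left mult.assoc)
qed

text \<open>
  By the preceding formula the term is one integral of \<open>f - \<gamma>\<close> against a cosine of frequency
  proportional to \<open>2 * n + 1\<close>, whose primitive is bounded by the reciprocal of that frequency.
\<close>

lemma AS_term_bound:
  assumes L: "L > 0" and f: "continuous_on {- L..L} f" and bv: "bounded_variation_on (- L) L f"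
  obtains C where "\<And>n x. \<bar>AS_term L f n x\<bar> \<le> C / (real n + 1)"
proof -
  define g where "g y = f y - AS_gamma L f" for y
  obtain V where V: "\<And>n t. t 0 = - L \<Longrightarrow> t n = L \<Longrightarrow> (\<forall>i<n. t i < t (Suc i)) \<Longrightarrow>
      (\<Sum>i<n. \<bar>f (t (Suc i)) - f (t i)\<bar>) \<le> V"
    using bv unfolding bounded_variation_on_def by metis
  define W where "W = \<bar>g (- L)\<bar> + \<bar>g L\<bar> + V"
  \<comment> \<open>The partition with the endpoints as its only nodes shows that \<open>V\<close> is nonnegative.\<close>
  have "0 \<le> (\<Sum>i<1. \<bar>f ((if Suc i = 0 then - L else L)) - f ((if i = 0 then - L else L))\<bar>)"
    by (intro sum_nonneg) auto
  also have "\<dots> \<le> V" using L by (intro V) auto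
  finally have W: "W \<ge> 0" by (simp add: W_def)
  have "\<bar>AS_term L f n x\<bar> \<le> (2 * W / pi) / (real n + 1)" for n x
  proof -
    define w where "w = (2 * real n + 1) * pi / (2 * L)"
    have w: "w > 0" using L by (simp add: w_def)
    have "\<bar>integral {- L..L} (\<lambda>y. g y * cos (w * (x - y)))\<bar> \<le> 1 / w * W"
      unfolding W_def
    proof (rule abs_integral_bounded_variation_le)
      show "((\<lambda>y. - sin (w * (x - y)) / w) has_real_derivative cos (w * (x - y))) (at y)" for y
        using w by (auto intro!: derivative_eq_intros)
      show "\<bar>- sin (w * (x - y)) / w\<bar> \<le> 1 / w" for y
        using w by (simp add: divide_right_mono)
    qed (use L V in \<open>auto simp: g_def intro!: continuous_intros f\<close>)
    moreover have angle: "(2 * real n + 1) * (pi * (x - y) / (2 * L)) = w * (x - y)" for y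
      by (simp add: w_def)
    ultimately have "\<bar>AS_term L f n x\<bar> \<le> 1 / L * (1 / w * W)"
      using L unfolding AS_term_eq_integral[OF L f] g_def angle abs_mult
      by (intro mult_mono) auto
    also have "\<dots> = 2 * W / pi * (1 / (2 * real n + 1))" using L by (simp add: w_def field_simps)
    also have "\<dots> \<le> 2 * W / pi * (1 / (real n + 1))"
      using W by (intro mult_left_mono divide_left_mono) auto
    finally show ?thesis by simp
  qed
  then show ?thesis by (rule that)
qed

lemma has_integral_mult_odd_dirichlet_kernel:
  assumes L: "L > 0" and f: "continuous_on {- L..L} f"
  shows "((\<lambda>y. (f y - AS_gamma L f) * odd_dirichlet_kernel m (pi * (x - y) / (2 * L)))
    has_integral L * (\<Sum>n<m. AS_term L f n x)) {- L..L}"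
proof -
  have "((\<lambda>y. (f y - AS_gamma L f) * cos ((2 * real n + 1) * (pi * (x - y) / (2 * L))))
      has_integral L * AS_term L f n x) {- L..L}" for n
  proof -
    have "continuous_on {- L..L}
        (\<lambda>y. (f y - AS_gamma L f) * cos ((2 * real n + 1) * (pi * (x - y) / (2 * L))))"
      using L by (intro continuous_intros f) auto
    from integrable_integral[OF integrable_continuous_interval[OF this]] show ?thesis
      using L by (simp add: AS_term_eq_integral[OF L f])
  qed
  then show ?thesis
    unfolding odd_dirichlet_kernel_def sum_distrib_left by (intro has_integral_sum) auto
qed

text \<open>
  The Tauberian theorem is applied to \<open>b m = (s m + s (Suc m)) / 2\<close> rather than to the partial sums
  \<open>s m\<close> themselves, because it is for \<open>b\<close> that the means have a kernel dominated by the Fejer kernel;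
  \<open>b\<close> inherits the \<open>O (1 / n)\<close> increments, and \<open>b m - s m\<close> is half the \<open>m\<close>-th term.
\<close>

lemma AS_partial_sums_uniform_limit:
  assumes L: "L > 0" and f: "continuous_on {- L..L} f" and bv: "bounded_variation_on (- L) L f"
  shows "uniform_limit {- L..L} (\<lambda>m x. \<Sum>n<m. AS_term L f n x)
    (\<lambda>x. f x - AS_gamma L f) sequentially"
proof -
  define g where "g y = f y - AS_gamma L f" for y
  define s where "s m x = (\<Sum>n<m. AS_term L f n x)" for m x
  define b where "b m x = (s m x + s (Suc m) x) / 2" for m x
  obtain C where C: "\<And>n x. \<bar>AS_term L f n x\<bar> \<le> C / (real n + 1)"
    using AS_term_bound[OF assms] by blast
  have C0: "C \<ge> 0" using order_trans[OF abs_ge_zero C[of 0 0]] by simp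
  have g: "continuous_on {- L..L} g" unfolding g_def by (intro continuous_intros f)
  have anti: "g (- L) = - g L" by (simp add: g_def AS_gamma_def field_simps)
  have limb: "uniform_limit {- L..L} b g sequentially"
  proof (rule hardy_tauberian_uniform)
    fix n x
    have "C / (real (Suc n) + 1) \<le> C / (real n + 1)" using C0 by (intro divide_left_mono) auto
    with C[of "Suc n" x] have "\<bar>AS_term L f (Suc n) x\<bar> \<le> C / (real n + 1)"
      by (rule order_trans)
    moreover have "b (Suc n) x - b n x = (AS_term L f n x + AS_term L f (Suc n) x) / 2"
      by (simp add: b_def s_def field_simps)
    ultimately show "\<bar>b (Suc n) x - b n x\<bar> \<le> C / (real n + 1)"
      using C[of n x] by (simp only: abs_le_iff) argo
  next
    fix e :: real assume e: "e > 0"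
    have rep: "integral {- L..L} (\<lambda>y. g y * (cos (pi * (x - y) / (2 * L)) *
        fejer_kernel N (pi * (x - y) / (2 * L)))) = 2 * L * (\<Sum>m<N. b m x)" for N x
    proof (rule integral_unique)
      have "((\<lambda>y. \<Sum>m<N. g y * odd_dirichlet_kernel m (pi * (x - y) / (2 * L)) +
            g y * odd_dirichlet_kernel (Suc m) (pi * (x - y) / (2 * L)))
          has_integral (\<Sum>m<N. L * s m x + L * s (Suc m) x)) {- L..L}"
        unfolding g_def s_def
        by (intro has_integral_sum has_integral_add has_integral_mult_odd_dirichlet_kernel L f) auto
      moreover have "(\<Sum>m<N. L * s m x + L * s (Suc m) x) = 2 * L * (\<Sum>m<N. b m x)"
        unfolding sum_distrib_left by (intro sum.cong) (auto simp: b_def algebra_simps)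
      ultimately show "((\<lambda>y. g y * (cos (pi * (x - y) / (2 * L)) *
          fejer_kernel N (pi * (x - y) / (2 * L)))) has_integral 2 * L * (\<Sum>m<N. b m x)) {- L..L}"
        by (simp add: cos_mult_fejer_kernel sum_distrib_left distrib_left)
    qed
    show "\<forall>\<^sub>F N in sequentially. \<forall>x\<in>{- L..L}. \<bar>\<Sum>m<N. b m x - g x\<bar> \<le> e * real N"
      using antiperiodic_fejer[OF L g anti e] unfolding rep
    proof (rule eventually_mono, intro ballI)
      fix N x assume H: "\<forall>x\<in>{- L..L}. \<bar>2 * L * (\<Sum>m<N. b m x) - 2 * L * real N * g x\<bar>
        \<le> e * (2 * L * real N)" and x: "x \<in> {- L..L}"
      have "2 * L * \<bar>\<Sum>m<N. b m x - g x\<bar> = \<bar>2 * L * (\<Sum>m<N. b m x) - 2 * L * real N * g x\<bar>"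
      proof -
        have "2 * L * (\<Sum>m<N. b m x) - 2 * L * real N * g x = 2 * L * (\<Sum>m<N. b m x - g x)"
          by (simp add: sum_subtractf right_diff_distrib mult.assoc)
        then show ?thesis using L by (simp add: abs_mult)
      qed
      also have "\<dots> \<le> 2 * L * (e * real N)" using H x by (simp add: algebra_simps)
      finally show "\<bar>\<Sum>m<N. b m x - g x\<bar> \<le> e * real N" using L by simp
    qed
  qed
  have "uniform_limit {- L..L} (\<lambda>n x. AS_term L f n x / 2) (\<lambda>x. 0) sequentially"
  proof (rule uniform_limitI)
    fix e :: real assume e: "e > 0"
    obtain N0 :: nat where N0: "C / e < real N0" using reals_Archimedean2 by blast
    have "dist (AS_term L f n x / 2) 0 < e" if "n \<ge> N0" for n x
    proof -
      have "C / e < real n + 1" using N0 that by linarith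
      then have "C / (real n + 1) < e" using e by (simp add: field_simps)
      with C[of n x] show ?thesis by simp
    qed
    then show "\<forall>\<^sub>F n in sequentially. \<forall>x\<in>{- L..L}. dist (AS_term L f n x / 2) 0 < e"
      by (auto simp: eventually_sequentially)
  qed
  from uniform_limit_minus[OF limb this] show ?thesis
    by (simp add: b_def s_def g_def add_divide_distrib)
qed

theorem theorem2p3:
  fixes L :: real and f :: "real \<Rightarrow> real"
  assumes "L > 0"
    and "continuous_on {- L..L} f"
    and "bounded_variation_on (- L) L f"
  shows "uniformly_convergent_on {- L..L} (\<lambda>m x. AS_gamma L f + (\<Sum>n=0..m. AS_term L f n x))
       \<and> (\<forall>x\<in>{- L..L}. AS L f x = f x)"
proof
  note lim = AS_partial_sums_uniform_limit[OF assms]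
  have "uniform_limit {- L..L} (\<lambda>m x. \<Sum>n<Suc m. AS_term L f n x)
      (\<lambda>x. f x - AS_gamma L f) sequentially"
    using filterlim_compose[OF lim filterlim_Suc] .
  from uniform_limit_add[OF uniform_limit_const[of "\<lambda>_. AS_gamma L f"] this]
  show "uniformly_convergent_on {- L..L} (\<lambda>m x. AS_gamma L f + (\<Sum>n=0..m. AS_term L f n x))"
    unfolding uniformly_convergent_on_def
    by (auto simp: atLeast0AtMost lessThan_Suc_atMost simp del: sum.lessThan_Suc)
  show "\<forall>x\<in>{- L..L}. AS L f x = f x"
  proof
    fix x assume "x \<in> {- L..L}"
    from tendsto_uniform_limitI[OF lim this]
    have "(\<lambda>n. AS_term L f n x) sums (f x - AS_gamma L f)" by (simp add: sums_def)
    then show "AS L f x = f x" by (simp add: AS_def sums_unique[symmetric])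
  qed
qed

end
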